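(* The polynomials $\alpha_n(x)=\operatorname{Re}((x+i)^n)$, $n\ge 0$, have the following properties. 1. The ordinary generating function is $$\sum_{n\geq 0}\alpha_{n}(x)z^{n}=\frac{1-xz}{1-2xz+(1+x^{2})z^{2}}.$$ 2. The exponential generating function is $$\sum_{n\geq 0}\alpha_{n}(x)\frac{z^{n}}{n!}=\cos(z)\,e^{xz}.$$ 3. For $n\ge 1$, $\alpha_{n+1}(x)=2x\,\alpha_{n}(x)-(1+x^{2})\,\alpha_{n-1}(x)$, with initial conditions $\alpha_{0}(x)=1$ and $\alpha_{1}(x)=x$. 4. For $n\ge 0$ (for the determinant, $n\ge 1$) and real $x$, $$\alpha_{n}(x)=\begin{pmatrix}1 & x\end{pmatrix}\begin{pmatrix}0 & -(1+x^{2})\\ 1 & 2x\end{pmatrix}^{n}\begin{pmatrix}1\\ 0\end{pmatrix}=\begin{vmatrix}x & -(1+x^{2}) & 0 & \cdots & 0\\ -1 & 2x & -(1+x^{2}) & & \vdots\\ 0 & -1 & \ddots & \ddots & 0\\ & & \ddots & \ddots & -(1+x^{2})\\ 0 & \cdots & 0 & -1 & 2x\end{vmatrix}=\left(\sqrt{1+x^{2}}\right)^{n}T_{n}\left(\frac{x}{\sqrt{1+x^{2}}}\right),$$ where the determinant is that of the $n\times n$ tridiagonal matrix whose $(1,1)$ entry is $x$, whose other diagonal entries are $2x$, whose superdiagonal entries are $-(1+x^2)$ and whose subdiagonal entries are $-1$, and $T_n$ is the $n$th Chebyshev polynomial of the first kind. 5. For $n\ge 0$, $\alpha_{n}(-x)=(-1)^{n}\alpha_{n}(x)$.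 6. For $n\ge 1$, $\dfrac{d}{dx}\alpha_{n}(x)=n\,\alpha_{n-1}(x)$. 7. For $n\ge 0$, $\alpha_n$ satisfies the linear second order ODE $$(1+x^{2})\,\alpha_{n}''(x)-2(n-1)x\,\alpha_{n}'(x)+n(n-1)\,\alpha_{n}(x)=0.$$ 8. For $n\ge 1$, $\alpha_{n}(x)$, which has degree $n$, has $n$ simple zeros in $\mathbb{R}$, at $$x_{k}=\cot\left(\frac{(2k-1)\pi}{2n}\right),\qquad k=1,\ldots,n.$$ 9. $\alpha_0(x)=1$ and, for $n\geq 0$, $$\alpha_{n+1}(x)=x\,\alpha_{n}(x)-\sum_{j=1}^{n}\frac{2^{j+1}(2^{j+1}-1)}{j+1}\binom{n}{j}\left\vert B_{j+1}\right\vert\alpha_{n-j}(x),$$ where $B_n$ denote the Bernoulli numbers.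
   Context: For each integer $n\ge 0$, $\alpha_n$ is the polynomial with real coefficients determined by $\alpha_n(x)=\operatorname{Re}((x+i)^{n})$ for real $x$, i.e. $\alpha_n(x)=\sum_{k=0}^{\lfloor n/2\rfloor}(-1)^k\binom{n}{2k}x^{n-2k}$. Generating function identities are understood as identities of formal power series in $z$. $T_n$ is the polynomial with $T_n(\cos\theta)=\cos(n\theta)$. The Bernoulli numbers are given by $\frac{t}{e^t-1}=\sum_{n\ge0}B_n\frac{t^n}{n!}$. An empty sum is $0$. *)

theory Defs
  imports
    Complex_Main
    "HOL-Computational_Algebra.Polynomial"
    "HOL-Computational_Algebra.Formal_Power_Series"
    "Jordan_Normal_Form.Determinant"
begin

definition alpha :: "nat \<Rightarrow> real poly" where
  "alpha n = (\<Sum>k\<le>n div 2. monom ((- 1) ^ k * of_nat (n choose (2 * k))) (n - 2 * k))"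

lemma poly_alpha: "poly (alpha n) x = Re ((of_real x + \<i>) ^ n)"
proof -
  let ?f = "\<lambda>k. of_nat (n choose k) * \<i> ^ k * (of_real x :: complex) ^ (n - k)"
  have "Re ((of_real x + \<i>) ^ n) = Re (\<Sum>k\<le>n. ?f k)"
    by (subst add.commute) (simp only: binomial_ring)
  also have "\<dots> = (\<Sum>k\<le>n. Re (?f k))"
    by simp
  also have "\<dots> = (\<Sum>k\<in>(\<lambda>k. 2 * k) ` {..n div 2}. Re (?f k))"
  proof (rule sum.mono_neutral_right)
    show "\<forall>k\<in>{..n} - (\<lambda>k. 2 * k) ` {..n div 2}. Re (?f k) = 0"
    proof
      fix k assume k: "k \<in> {..n} - (\<lambda>k. 2 * k) ` {..n div 2}"
      have "odd k"
      proof
        assume "even k"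
        then obtain m where "k = 2 * m" by blast
        with k show False by auto
      qed
      then obtain m where m: "k = 2 * m + 1" by (rule oddE)
      have "?f k = of_real (of_nat (n choose k) * (- 1) ^ m * x ^ (n - k)) * \<i>"
        by (simp add: m power_mult)
      moreover have "Re (of_real r * \<i>) = 0" for r by simp
      ultimately show "Re (?f k) = 0" by (simp only:)
    qed
  qed auto
  also have "\<dots> = (\<Sum>k\<le>n div 2. Re (?f (2 * k)))"
    by (subst sum.reindex) (auto simp: inj_on_def)
  also have "\<dots> = (\<Sum>k\<le>n div 2. (- 1) ^ k * of_nat (n choose (2 * k)) * x ^ (n - 2 * k))"
  proof (rule sum.cong)
    fix k
    have "?f (2 * k) = of_real ((- 1) ^ k * of_nat (n choose (2 * k)) * x ^ (n - 2 * k))"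
      by (simp add: power_mult)
    thus "Re (?f (2 * k)) = (- 1) ^ k * of_nat (n choose (2 * k)) * x ^ (n - 2 * k)"
      by (simp only: Re_complex_of_real)
  qed simp
  also have "\<dots> = poly (alpha n) x"
    by (simp add: alpha_def poly_sum poly_monom)
  finally show ?thesis ..
qed

definition chebyshev_T :: "nat \<Rightarrow> real poly" where
  "chebyshev_T n = (THE p. \<forall>\<theta>. poly p (cos \<theta>) = cos (real n * \<theta>))"

lemma chebyshev_T_ex1: "\<exists>!p. \<forall>\<theta>. poly p (cos \<theta>) = cos (real n * \<theta>)"
proof -
  have "\<exists>p q. (\<forall>\<theta>. poly p (cos \<theta>) = cos (real n * \<theta>)) \<and>
              (\<forall>\<theta>. poly q (cos \<theta>) = cos (real (Suc n) * \<theta>))"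
  proof (induction n)
    case 0
    show ?case by (rule exI[of _ 1], rule exI[of _ "[:0, 1:]"]) simp
  next
    case (Suc n)
    then obtain p q where p: "\<And>\<theta>. poly p (cos \<theta>) = cos (real n * \<theta>)"
      and q: "\<And>\<theta>. poly q (cos \<theta>) = cos (real (Suc n) * \<theta>)" by blast
    have "poly ([:0, 2:] * q - p) (cos \<theta>) = cos (real (Suc (Suc n)) * \<theta>)" for \<theta>
    proof -
      have "cos (real (Suc (Suc n)) * \<theta>) = cos (real (Suc n) * \<theta> + \<theta>)"
        "cos (real n * \<theta>) = cos (real (Suc n) * \<theta> - \<theta>)"
        by (simp_all add: algebra_simps)
      thus ?thesis by (simp add: p q cos_add cos_diff del: of_nat_Suc)
    qed
    with q show ?case by blast
  qed
  moreover have "p = q" if "\<forall>\<theta>. poly p (cos \<theta>) = cos (real n * \<theta>)"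
    "\<forall>\<theta>. poly q (cos \<theta>) = cos (real n * \<theta>)" for p q
  proof (rule ccontr)
    assume "p \<noteq> q"
    hence "finite {x. poly (p - q) x = 0}" by (intro poly_roots_finite) simp
    moreover have "{-1..1} \<subseteq> {x. poly (p - q) x = 0}"
    proof
      fix x :: real assume "x \<in> {-1..1}"
      hence "x = cos (arccos x)" by simp
      with that show "x \<in> {x. poly (p - q) x = 0}"
        by (metis (mono_tags, lifting) mem_Collect_eq poly_diff right_minus_eq)
    qed
    ultimately have "finite {-1..1::real}" by (rule rev_finite_subset)
    thus False by (simp add: infinite_Icc)
  qed
  ultimately show ?thesis by blast
qed

lemma poly_chebyshev_T_cos: "poly (chebyshev_T n) (cos \<theta>) = cos (real n * \<theta>)"
  using theI'[OF chebyshev_T_ex1[of n]] unfolding chebyshev_T_def by blast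

definition bernoulli_number :: "nat \<Rightarrow> real" where
  "bernoulli_number n = fact n * fps_nth (fps_X / (fps_exp 1 - 1)) n"

lemma bernoulli_number_gf:
  "Abs_fps (\<lambda>n. bernoulli_number n / fact n) = fps_X / (fps_exp 1 - 1)"
  by (rule fps_ext) (simp add: bernoulli_number_def)

(* The division defining the Bernoulli numbers is exact. *)
lemma bernoulli_number_gf_mult:
  "Abs_fps (\<lambda>n. bernoulli_number n / fact n) * (fps_exp 1 - 1) = fps_X"
proof -
  have nz: "fps_nth (fps_exp 1 - 1 :: real fps) 1 \<noteq> 0" by simp
  hence "subdegree (fps_exp 1 - 1 :: real fps) = 1"
    by (intro subdegreeI) auto
  moreover from nz have "fps_exp 1 - 1 \<noteq> (0 :: real fps)" by force
  ultimately have "(fps_exp 1 - 1 :: real fps) dvd fps_X"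
    by (subst fps_dvd_iff) auto
  thus ?thesis by (simp add: bernoulli_number_gf)
qed

(* Rows and columns are indexed from 0. *)
definition alpha_tridiagonal :: "nat \<Rightarrow> real \<Rightarrow> real mat" where
  "alpha_tridiagonal n x = mat n n (\<lambda>(i, j).
     if i = j then (if i = 0 then x else 2 * x)
     else if j = Suc i then - (1 + x\<^sup>2)
     else if i = Suc j then - 1
     else 0)"

end

theory Submission
  imports Defs
begin

text \<open>
  Together with the imaginary parts \<open>\<beta>\<^sub>n(x) = Im ((x + \<i>)\<^sup>n)\<close>, multiplication by \<open>x + \<i>\<close>
  is the linear system \<open>\<alpha>\<^sub>n\<^sub>+\<^sub>1 = x \<alpha>\<^sub>n - \<beta>\<^sub>n\<close>, \<open>\<beta>\<^sub>n\<^sub>+\<^sub>1 = \<alpha>\<^sub>n + x \<beta>\<^sub>n\<close>, which yields the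
  three-term recurrence, the generating functions, the derivative and the matrix formulas by
  induction. Writing \<open>x + \<i>\<close> in polar form gives the Chebyshev formula and, with
  \<open>cot t + \<i> = exp (\<i> t) / sin t\<close>, the zeros; they are simple because
  \<open>\<alpha>\<^sub>n(x) = \<alpha>\<^sub>n\<^sub>-\<^sub>1(x) = 0\<close> would force \<open>(x + \<i>)\<^sup>n\<^sup>-\<^sup>1 = 0\<close>. For the last recurrence,
  the exponential generating function \<open>F\<close> satisfies \<open>F' = (x - tan z) F\<close>. The coefficients of
  \<open>tanh\<close> follow from \<open>z tanh z = z + b(4z) - b(2z)\<close> with \<open>b(z) = z / (exp z - 1)\<close>, and the
  Riccati equations \<open>T' = 1 + T\<^sup>2\<close> and \<open>H' = 1 - H\<^sup>2\<close> show that those of \<open>tan\<close> are their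
  absolute values.
\<close>

section \<open>Real and imaginary parts of the powers of \<open>x + \<i>\<close>\<close>

definition beta :: "nat \<Rightarrow> real \<Rightarrow> real" where
  "beta n x = Im ((of_real x + \<i>) ^ n)"

lemma poly_alpha_0: "poly (alpha 0) x = 1"
  by (simp add: poly_alpha)

lemma beta_0: "beta 0 x = 0"
  by (simp add: beta_def)

lemma poly_alpha_Suc: "poly (alpha (Suc n)) x = x * poly (alpha n) x - beta n x"
  by (simp add: poly_alpha beta_def)

lemma beta_Suc: "beta (Suc n) x = poly (alpha n) x + x * beta n x"
  by (simp add: poly_alpha beta_def)

text \<open>Eliminating \<open>beta\<close> from the linear system reflects that
  \<open>x + \<i>\<close> is a root of
  \<open>w\<^sup>2 - 2 * x * w + (1 + x\<^sup>2)\<close>.\<close>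

lemma poly_alpha_recurrence:
  "poly (alpha (Suc (Suc n))) x = 2 * x * poly (alpha (Suc n)) x - (1 + x\<^sup>2) * poly (alpha n) x"
  by (simp add: poly_alpha_Suc beta_Suc algebra_simps power2_eq_square)

lemma alpha_0: "alpha 0 = 1"
  by (simp add: poly_eq_poly_eq_iff[symmetric] fun_eq_iff poly_alpha_0)

section \<open>Ordinary and exponential generating functions\<close>

lemma alpha_ogf:
  "Abs_fps (\<lambda>n. poly (alpha n) x) =
     (1 - fps_const x * fps_X) /
     (1 - fps_const (2 * x) * fps_X + fps_const (1 + x\<^sup>2) * fps_X\<^sup>2)"
    (is "?A = ?N / ?D")
proof -
  have "?A * ?D = ?A - fps_const (2 * x) * (fps_X * ?A) + fps_const (1 + x\<^sup>2) * (fps_X ^ 2 * ?A)"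
    by (simp add: algebra_simps)
  also have "\<dots> = ?N"
  proof (rule fps_ext)
    fix n
    show "fps_nth (?A - fps_const (2 * x) * (fps_X * ?A) + fps_const (1 + x\<^sup>2) * (fps_X ^ 2 * ?A)) n
      = fps_nth ?N n"
    \<comment> \<open>From index 2 on, the coefficient vanishes by the three-term recurrence;
      indices 0 and 1 give the numerator's \<open>1\<close> and \<open>- x\<close>.\<close>
    proof (induction n rule: induct_nat_012)
      case (ge2 n)
      show ?case by (simp add: fps_X_power_mult_nth poly_alpha_recurrence)
    qed (simp_all add: fps_X_power_mult_nth poly_alpha_0 poly_alpha_Suc beta_0)
  qed
  finally have "?A * ?D = ?N" .
  moreover have "fps_nth ?D 0 \<noteq> 0" by simp
  hence "?D \<noteq> 0" by (metis fps_zero_nth)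
  ultimately show ?thesis by (metis nonzero_mult_div_cancel_right)
qed

lemma fps_cos_1_deriv: "fps_deriv (fps_cos 1) = - fps_sin (1 :: real)"
  by (simp add: fps_cos_deriv fps_const_neg[symmetric] del: fps_const_neg)

text \<open>The series \<open>?C\<close> and \<open>?S\<close> are the real and imaginary parts of
  \<open>exp ((x + \<i>) z)\<close>. Their derivatives satisfy the same linear system as
  \<open>alpha\<close> and \<open>beta\<close>, so both coefficient sequences are identified
  together.\<close>

lemma alpha_egf: "Abs_fps (\<lambda>n. poly (alpha n) x / fact n) = fps_cos 1 * fps_exp x"
proof -
  let ?C = "fps_cos 1 * fps_exp x" and ?S = "fps_sin 1 * fps_exp x"
  have C: "fps_deriv ?C = fps_const x * ?C - ?S"
    by (simp add: fps_cos_1_deriv algebra_simps)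
  have S: "fps_deriv ?S = fps_const x * ?S + ?C"
    by (simp add: fps_sin_deriv algebra_simps)
  have "fps_nth ?C n = poly (alpha n) x / fact n \<and> fps_nth ?S n = beta n x / fact n" for n
  proof (induction n)
    case 0
    show ?case by (simp add: poly_alpha_0 beta_0)
  next
    case (Suc n)
    have "of_nat (Suc n) * fps_nth ?C (Suc n) = x * fps_nth ?C n - fps_nth ?S n"
      using arg_cong[OF C, of "\<lambda>f. fps_nth f n"]
      by (simp only: fps_deriv_nth fps_sub_nth fps_mult_left_const_nth Suc_eq_plus1)
    moreover have "of_nat (Suc n) * fps_nth ?S (Suc n) = x * fps_nth ?S n + fps_nth ?C n"
      using arg_cong[OF S, of "\<lambda>f. fps_nth f n"]
      by (simp only: fps_deriv_nth fps_add_nth fps_mult_left_const_nth Suc_eq_plus1)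
    ultimately show ?case using Suc.IH
      by (simp add: poly_alpha_Suc beta_Suc field_simps del: of_nat_Suc)
  qed
  thus ?thesis by (simp add: fps_eq_iff)
qed

section \<open>Matrix power, determinant and Chebyshev forms\<close>

lemma alpha_matrix_power:
  "vec_of_list [1, x] \<bullet>
     ((mat_of_rows_list 2 [[0, - (1 + x\<^sup>2)], [1, 2 * x]] ^\<^sub>m n) *\<^sub>v vec_of_list [1, 0])
   = poly (alpha n) x"
proof -
  \<comment> \<open>\<open>M\<close> is multiplication by \<open>x + \<i>\<close> in the real basis
    \<open>1\<close>, \<open>x + \<i>\<close> of the complex numbers, and \<open>[1, x]\<close>
    lists the real parts of that basis.\<close>
  define M where "M = mat_of_rows_list 2 [[0, - (1 + x\<^sup>2)], [1, 2 * x]]"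
  have M: "M \<in> carrier_mat 2 2"
    by (simp add: M_def mat_of_rows_list_def numeral_2_eq_2)
  have v: "vec_of_list [a, b] \<in> carrier_vec 2" for a b :: real
    by (rule carrier_vecI) simp
  have step: "M *\<^sub>v vec_of_list [a, b] = vec_of_list [- (1 + x\<^sup>2) * b, a + 2 * x * b]" for a b
    by (rule eq_vecI)
      (auto simp: M_def mat_of_rows_list_def scalar_prod_def vec_of_list_index less_Suc_eq
        numeral_2_eq_2)
  have pow: "(M ^\<^sub>m n) *\<^sub>v vec_of_list [a, b] = ((\<lambda>v. M *\<^sub>v v) ^^ n) (vec_of_list [a, b])" for a b n
  proof (induction n arbitrary: a b)
    case 0
    show ?case using M v by simp
  next
    case (Suc n)
    have "(M ^\<^sub>m Suc n) *\<^sub>v vec_of_list [a, b] = (M ^\<^sub>m n) *\<^sub>v (M *\<^sub>v vec_of_list [a, b])"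
      using assoc_mult_mat_vec[OF pow_carrier_mat[OF M] M v] by simp
    also have "\<dots> = ((\<lambda>v. M *\<^sub>v v) ^^ n) (M *\<^sub>v vec_of_list [a, b])"
      by (simp only: step Suc.IH)
    finally show ?case by (simp only: funpow_Suc_right o_apply)
  qed
  \<comment> \<open>These are the coordinates of \<open>(x + \<i>) ^ n\<close> in the basis
    \<open>1\<close>, \<open>x + \<i>\<close>.\<close>
  have "((\<lambda>v. M *\<^sub>v v) ^^ n) (vec_of_list [1, 0]) =
      vec_of_list [poly (alpha n) x - x * beta n x, beta n x]"
  proof (induction n)
    case 0
    show ?case by (simp add: poly_alpha_0 beta_0)
  next
    case (Suc n)
    thus ?case
      by (simp add: step poly_alpha_Suc beta_Suc algebra_simps power2_eq_square del: vec_of_list_Cons)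
  qed
  thus ?thesis
    unfolding M_def[symmetric] pow by simp
qed

text \<open>The continuant recurrence: expansion along the last row leaves two minors, and the
  second is expanded along its last column.\<close>

lemma det_tridiagonal:
  fixes a b c :: "nat \<Rightarrow> 'a :: comm_ring_1"
  defines "A \<equiv> \<lambda>n. mat n n (\<lambda>(i, j).
     if i = j then a i else if j = Suc i then b i else if i = Suc j then c j else 0)"
  shows "det (A (Suc (Suc n))) = a (Suc n) * det (A (Suc n)) - b n * c n * det (A n)"
proof -
  \<comment> \<open>Deleting the last row and the next-to-last column leaves a matrix whose last
    column has \<open>b n\<close> at the bottom and zeros elsewhere.\<close>
  let ?B = "mat_delete (A (Suc (Suc n))) (Suc n) n"
  have A: "A n \<in> carrier_mat n n" for n by (simp add: A_def)
  have B: "?B \<in> carrier_mat (Suc n) (Suc n)"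
    using mat_delete_carrier[OF A[of "Suc (Suc n)"]] by simp
  have del: "mat_delete (A (Suc m)) m m = A m" for m
    by (rule eq_matI) (auto simp: mat_delete_def A_def)
  have "mat_delete ?B n n = A n"
    by (rule eq_matI) (auto simp: mat_delete_def A_def)
  have "det ?B = (\<Sum>i<Suc n. ?B $$ (i, n) * cofactor ?B i n)"
    by (rule laplace_expansion_column[OF B]) simp
  also have "\<dots> = b n * det (A n)"
    by (simp add: cofactor_def \<open>mat_delete ?B n n = A n\<close>)
      (simp add: mat_delete_def A_def)
  finally have detB: "det ?B = b n * det (A n)" .
  have "det (A (Suc (Suc n))) =
      (\<Sum>j<Suc (Suc n). A (Suc (Suc n)) $$ (Suc n, j) * cofactor (A (Suc (Suc n))) (Suc n) j)"
    by (rule laplace_expansion_row[OF A]) simp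
  also have "\<dots> = a (Suc n) * det (A (Suc n)) - c n * det ?B"
    by (simp add: cofactor_def del) (simp add: A_def)
  finally show ?thesis by (simp add: detB algebra_simps)
qed

text \<open>Paired off-diagonal entries have product \<open>1 + x\<^sup>2\<close>, so the continuant
  recurrence becomes that of \<open>alpha\<close>; the empty determinant is 1.\<close>

lemma det_alpha_tridiagonal: "det (alpha_tridiagonal n x) = poly (alpha n) x"
proof (induction n rule: induct_nat_012)
  case 0
  show ?case by (simp add: alpha_tridiagonal_def poly_alpha_0)
next
  case 1
  show ?case
    by (simp add: alpha_tridiagonal_def det_single poly_alpha_0 poly_alpha_Suc beta_0)
next
  case (ge2 n)
  show ?case
    using det_tridiagonal[of n "\<lambda>i. if i = 0 then x else 2 * x" "\<lambda>_. - (1 + x\<^sup>2)" "\<lambda>_. -1"] ge2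
    by (simp add: alpha_tridiagonal_def poly_alpha_recurrence algebra_simps)
qed

lemma alpha_chebyshev:
  "poly (alpha n) x = sqrt (1 + x\<^sup>2) ^ n * poly (chebyshev_T n) (x / sqrt (1 + x\<^sup>2))"
proof -
  define r where "r = sqrt (1 + x\<^sup>2)"
  have r: "r > 0" "r\<^sup>2 = 1 + x\<^sup>2"
    by (simp_all add: r_def add_pos_nonneg)
  have "(x / r)\<^sup>2 + (1 / r)\<^sup>2 = (1 + x\<^sup>2) / r\<^sup>2"
    by (simp add: power_divide add_divide_distrib)
  also have "\<dots> = 1" using r(1) unfolding r(2)[symmetric] by simp
  finally have "(x / r)\<^sup>2 + (1 / r)\<^sup>2 = 1" .
  \<comment> \<open>The angle \<open>t\<close> is the argument of \<open>x + \<i>\<close>, whose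
    modulus is \<open>r\<close>.\<close>
  then obtain t where t: "x / r = cos t" "1 / r = sin t"
    using sincos_total_2pi by metis
  have "of_real x + \<i> = of_real r * cis t"
    using r t by (auto simp: complex_eq_iff field_simps)
  hence "(of_real x + \<i>) ^ n = of_real (r ^ n) * cis (real n * t)"
    by (simp add: power_mult_distrib DeMoivre)
  hence "poly (alpha n) x = r ^ n * cos (real n * t)"
    by (simp add: poly_alpha)
  thus ?thesis
    unfolding r_def[symmetric] t(1) by (simp add: poly_chebyshev_T_cos)
qed

section \<open>Parity, derivative and differential equation\<close>

lemma poly_alpha_minus: "poly (alpha n) (- x) = (- 1) ^ n * poly (alpha n) x"
proof (induction n rule: induct_nat_012)
  case (ge2 n)
  thus ?case by (simp add: poly_alpha_recurrence algebra_simps)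
qed (simp_all add: poly_alpha_0 poly_alpha_Suc beta_0)

text \<open>These are the real and imaginary parts of the power rule for
  \<open>(x + \<i>) ^ Suc n\<close>. They are proved jointly because the linear system couples
  them.\<close>

lemma alpha_beta_has_derivative:
  "(poly (alpha (Suc n)) has_real_derivative real (Suc n) * poly (alpha n) x) (at x)
   \<and> (beta (Suc n) has_real_derivative real (Suc n) * beta n x) (at x)"
proof (induction n)
  case 0
  have "poly (alpha (Suc 0)) = (\<lambda>x. x)" "beta (Suc 0) = (\<lambda>x. 1)"
    by (simp_all add: fun_eq_iff poly_alpha_0 poly_alpha_Suc beta_0 beta_Suc)
  thus ?case by (simp add: poly_alpha_0 beta_0)
next
  case (Suc n)
  note IH [derivative_intros] = conjunct1[OF Suc] conjunct2[OF Suc]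
  have "poly (alpha (Suc (Suc n))) = (\<lambda>x. x * poly (alpha (Suc n)) x - beta (Suc n) x)"
    "beta (Suc (Suc n)) = (\<lambda>x. poly (alpha (Suc n)) x + x * beta (Suc n) x)"
    by (simp_all add: fun_eq_iff poly_alpha_Suc[of "Suc n"] beta_Suc[of "Suc n"])
  moreover have "((\<lambda>x. x * poly (alpha (Suc n)) x - beta (Suc n) x) has_real_derivative
      real (Suc (Suc n)) * poly (alpha (Suc n)) x) (at x)"
    by (rule DERIV_cong, (rule IH derivative_intros)+)
      (simp add: poly_alpha_Suc algebra_simps)
  moreover have "((\<lambda>x. poly (alpha (Suc n)) x + x * beta (Suc n) x) has_real_derivative
      real (Suc (Suc n)) * beta (Suc n) x) (at x)"
    by (rule DERIV_cong, (rule IH derivative_intros)+)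
      (simp add: beta_Suc algebra_simps)
  ultimately show ?case by simp
qed

text \<open>At \<open>n = 0\<close> the factor \<open>real n\<close> vanishes, which makes the
  truncated index \<open>n - 1\<close> harmless.\<close>

lemma pderiv_alpha: "pderiv (alpha n) = smult (real n) (alpha (n - 1))"
proof (cases n)
  case 0
  thus ?thesis by (simp add: alpha_0)
next
  case (Suc m)
  have "poly (pderiv (alpha (Suc m))) x = real (Suc m) * poly (alpha m) x" for x
    using DERIV_unique[OF poly_DERIV conjunct1[OF alpha_beta_has_derivative]] .
  thus ?thesis
    by (simp add: Suc poly_eq_poly_eq_iff[symmetric] fun_eq_iff)
qed

text \<open>Applying the derivative formula twice turns the equation into \<open>n * (n - 1)\<close>
  times the three-term recurrence.\<close>

lemma alpha_ode:
  "(1 + x\<^sup>2) * poly (pderiv (pderiv (alpha n))) x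
     - 2 * (real n - 1) * x * poly (pderiv (alpha n)) x
     + real n * (real n - 1) * poly (alpha n) x = 0"
proof (induction n rule: induct_nat_012)
  case (ge2 n)
  show ?case
    by (simp add: pderiv_alpha pderiv_smult poly_alpha_recurrence algebra_simps)
qed (simp_all add: pderiv_alpha alpha_0 pderiv_smult)

section \<open>Degree and zeros\<close>

lemma degree_alpha: "degree (alpha n) = n"
proof (rule antisym)
  show "degree (alpha n) \<le> n"
    unfolding alpha_def
    by (rule degree_sum_le) (auto intro: order.trans[OF degree_monom_le])
  \<comment> \<open>Only \<open>k = 0\<close> gives a monomial of exponent \<open>n\<close>.\<close>
  have "coeff (alpha n) n =
      (\<Sum>k\<le>n div 2. if k = 0 then (- 1) ^ k * of_nat (n choose (2 * k)) else 0)"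
    unfolding alpha_def coeff_sum
    by (rule sum.cong) auto
  also have "\<dots> = 1" by (subst sum.delta) auto
  finally show "n \<le> degree (alpha n)" by (intro le_degree) simp
qed

lemma poly_alpha_cot:
  assumes "sin t \<noteq> 0"
  shows "poly (alpha n) (cot t) = cos (real n * t) / sin t ^ n"
proof -
  have "of_real (cot t) + \<i> = cis t / of_real (sin t)"
    using assms by (auto simp: complex_eq_iff cot_def)
  hence "(of_real (cot t) + \<i>) ^ n = cis (real n * t) / of_real (sin t ^ n)"
    by (simp add: power_divide DeMoivre)
  thus ?thesis by (simp add: poly_alpha)
qed

text \<open>The derivative is a nonzero multiple of the preceding polynomial, so it suffices that
  consecutive polynomials share no zero.\<close>

lemma alpha_simple_root:
  assumes "poly (alpha n) x = 0"
  shows "order x (alpha n) = 1"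
proof -
  from assms obtain m where n: "n = Suc m"
    by (cases n) (auto simp: poly_alpha_0)
  have "poly (alpha m) x \<noteq> 0"
  proof
    assume "poly (alpha m) x = 0"
    with assms have "beta m x = 0" by (simp add: n poly_alpha_Suc)
    with \<open>poly (alpha m) x = 0\<close> have "(of_real x + \<i>) ^ m = 0"
      by (simp add: complex_eq_iff poly_alpha beta_def)
    hence "of_real x + \<i> = 0" by simp
    thus False by (simp add: complex_eq_iff)
  qed
  hence d: "poly (pderiv (alpha n)) x \<noteq> 0"
    by (simp add: pderiv_alpha n)
  hence "alpha n \<noteq> 0" by auto
  thus ?thesis using assms d by (simp add: order_pderiv order_0I)
qed

text \<open>Equal cotangents force \<open>sin (s - t) = 0\<close>, while \<open>s - t\<close> lies
  strictly between \<open>- pi\<close> and \<open>pi\<close>.\<close>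

lemma cot_inj_on: "inj_on cot {0<..<pi}"
proof (rule inj_onI)
  fix s t :: real assume "s \<in> {0<..<pi}" "t \<in> {0<..<pi}" "cot s = cot t"
  hence st: "0 < s" "s < pi" "0 < t" "t < pi" and "sin s > 0" "sin t > 0"
    by (auto intro: sin_gt_zero)
  with \<open>cot s = cot t\<close> have "sin (s - t) = 0"
    by (simp add: cot_def sin_diff field_simps)
  then obtain k :: int where k: "s - t = of_int k * pi"
    by (auto simp: sin_zero_iff_int2)
  have "\<bar>of_int k * pi\<bar> < pi" using st unfolding k[symmetric] by auto
  hence "k = 0" by (simp add: abs_mult)
  with k show "s = t" by simp
qed

lemma alpha_roots:
  fixes n :: nat
  defines "X \<equiv> \<lambda>k. cot ((2 * real k - 1) * pi / (2 * real n))"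
  assumes "n \<ge> 1"
  shows "inj_on X {1..n}" "{x. poly (alpha n) x = 0} = X ` {1..n}"
proof -
  define t where "t = (\<lambda>k. (2 * real k - 1) * pi / (2 * real n))"
  have X: "X = cot \<circ> t" by (simp add: X_def t_def fun_eq_iff)
  have t: "t k \<in> {0<..<pi}" if "k \<in> {1..n}" for k
  proof -
    have "(2 * real k - 1) * pi < 2 * real n * pi"
      using that by (intro mult_strict_right_mono) auto
    thus ?thesis using that by (auto simp: t_def field_simps)
  qed
  have "inj_on t {1..n}"
    using \<open>n \<ge> 1\<close> by (auto simp: inj_on_def t_def)
  moreover have "inj_on cot (t ` {1..n})"
    using t by (intro inj_on_subset[OF cot_inj_on]) auto
  ultimately show inj: "inj_on X {1..n}"
    unfolding X by (rule comp_inj_on)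
  have "poly (alpha n) (X k) = 0" if "k \<in> {1..n}" for k
  proof -
    have "sin (t k) \<noteq> 0" using t[OF that] sin_gt_zero[of "t k"] by auto
    \<comment> \<open>An odd multiple of \<open>pi / 2\<close>, where the cosine vanishes.\<close>
    moreover have "real n * t k = of_int (2 * int k - 1) * (pi / 2)"
      using \<open>n \<ge> 1\<close> by (simp add: t_def)
    hence "cos (real n * t k) = 0"
      unfolding cos_zero_iff_int by (intro exI[of _ "2 * int k - 1"]) simp
    ultimately show ?thesis by (simp add: X poly_alpha_cot)
  qed
  hence sub: "X ` {1..n} \<subseteq> {x. poly (alpha n) x = 0}" by auto
  have nz: "alpha n \<noteq> 0" using degree_alpha[of n] \<open>n \<ge> 1\<close> by auto
  \<comment> \<open>By the degree bound, the \<open>n\<close> distinct zeros already found are all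
    of them.\<close>
  have "card {x. poly (alpha n) x = 0} \<le> n"
    using card_poly_roots_bound[OF nz] by (simp add: degree_alpha)
  hence "card {x. poly (alpha n) x = 0} \<le> card (X ` {1..n})"
    using inj by (simp add: card_image)
  with sub show "{x. poly (alpha n) x = 0} = X ` {1..n}"
    using poly_roots_finite[OF nz] card_seteq by metis
qed

section \<open>Coefficients of the tangent via the hyperbolic tangent and Bernoulli numbers\<close>

lemma fps_riccati_nth:
  fixes H T :: "real fps"
  assumes H: "fps_deriv H = 1 - H\<^sup>2" "fps_nth H 0 = 0"
    and T: "fps_deriv T = 1 + T\<^sup>2" "fps_nth T 0 = 0"
  shows "fps_nth T n \<ge> 0 \<and> (even n \<longrightarrow> fps_nth T n = 0)
    \<and> fps_nth H n = (- 1) ^ (n div 2) * fps_nth T n"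
\<comment> \<open>This is the coefficient form of \<open>tanh z = - \<i> * tan (\<i> * z)\<close>.
  Induction is strong because the square is a convolution of all lower coefficients.\<close>
proof (induction n rule: less_induct)
  case (less n)
  show ?case
  proof (cases n)
    case 0
    thus ?thesis using H(2) T(2) by simp
  next
    case (Suc m)
    define S where "S = (\<Sum>i=0..m. fps_nth T i * fps_nth T (m - i))"
    have IH: "fps_nth T i \<ge> 0" "even i \<Longrightarrow> fps_nth T i = 0"
      "fps_nth H i = (- 1) ^ (i div 2) * fps_nth T i" if "i \<le> m" for i
      using less.IH[of i] that Suc by auto
    have T': "real (Suc m) * fps_nth T (Suc m) = (if m = 0 then 1 else 0) + S"
      using arg_cong[OF T(1), of "\<lambda>f. fps_nth f m"]
      by (simp add: S_def power2_eq_square fps_mult_nth)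
    have H': "real (Suc m) * fps_nth H (Suc m) =
        (if m = 0 then 1 else 0) - (\<Sum>i=0..m. fps_nth H i * fps_nth H (m - i))"
      using arg_cong[OF H(1), of "\<lambda>f. fps_nth f m"]
      by (simp add: power2_eq_square fps_mult_nth)
    have S0: "S \<ge> 0" unfolding S_def by (intro sum_nonneg mult_nonneg_nonneg IH) auto
    have odd: "S = 0" if "odd m"
      unfolding S_def
    proof (rule sum.neutral, rule ballI)
      fix i assume "i \<in> {0..m}"
      hence "i \<le> m" by simp
      moreover have "even i \<or> even (m - i)" using that \<open>i \<le> m\<close> by auto
      ultimately show "fps_nth T i * fps_nth T (m - i) = 0" using IH(2) by auto
    qed
    have "fps_nth H i * fps_nth H (m - i) =
        - ((- 1) ^ (Suc m div 2) * (fps_nth T i * fps_nth T (m - i)))" if "i \<le> m" for i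
    \<comment> \<open>For two odd indices, \<open>i div 2 + (m - i) div 2\<close> is one less than
      \<open>Suc m div 2\<close>. The resulting minus sign turns \<open>1 - H\<^sup>2\<close> into
      \<open>1 + T\<^sup>2\<close>. Otherwise an even index makes both products zero.\<close>
    proof (cases "odd i \<and> odd (m - i)")
      case True
      then obtain p q where pq: "i = 2 * p + 1" "m - i = 2 * q + 1" by (elim conjE oddE)
      hence "Suc m div 2 = Suc (p + q)" using that by simp
      thus ?thesis using that pq IH(3)[of i] IH(3)[of "m - i"]
        by (simp add: power_add)
    next
      case False
      thus ?thesis using that IH(2)[of i] IH(2)[of "m - i"] IH(3)[of i] IH(3)[of "m - i"]
        by auto
    qed
    hence HS: "(\<Sum>i=0..m. fps_nth H i * fps_nth H (m - i)) = - ((- 1) ^ (Suc m div 2) * S)"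
      by (simp add: S_def sum_distrib_left sum_negf[symmetric])
    \<comment> \<open>The constant 1 occurs only at \<open>m = 0\<close>, where the sign is
      \<open>+1\<close>, so it can be put under the common sign.\<close>
    have "real (Suc m) * fps_nth H (Suc m) =
        (- 1) ^ (Suc m div 2) * ((if m = 0 then 1 else 0) + S)"
      unfolding H' HS by (simp add: distrib_left)
    hence "real (Suc m) * fps_nth H (Suc m) =
        real (Suc m) * ((- 1) ^ (Suc m div 2) * fps_nth T (Suc m))"
      unfolding T'[symmetric] by (simp only: mult.left_commute)
    hence "fps_nth H (Suc m) = (- 1) ^ (Suc m div 2) * fps_nth T (Suc m)"
      by (subst (asm) mult_left_cancel) simp_all
    moreover have "fps_nth T (Suc m) = ((if m = 0 then 1 else 0) + S) / real (Suc m)"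
      using T' by (simp add: field_simps)
    ultimately show ?thesis
      using S0 odd by (auto simp: Suc)
  qed
qed

text \<open>This form of \<open>(exp (2 z) - 1) / (exp (2 z) + 1)\<close> has a single inverse, of a
  series with constant term 2.\<close>

definition fps_tanh :: "real fps" where
  "fps_tanh = 1 - 2 * inverse (fps_exp 2 + 1)"

lemma fps_tanh_mult: "fps_tanh * (fps_exp 2 + 1) = fps_exp 2 - 1"
proof -
  have "inverse (fps_exp 2 + 1) * (fps_exp 2 + 1 :: real fps) = 1"
    by (rule inverse_mult_eq_1) simp
  thus ?thesis by (simp add: fps_tanh_def left_diff_distrib mult.assoc)
qed

lemma fps_tanh_deriv: "fps_deriv fps_tanh = 1 - fps_tanh\<^sup>2"
proof -
  let ?V = "inverse (fps_exp 2 + 1 :: real fps)"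
  \<comment> \<open>Eliminating the exponential makes the derivative of \<open>?V\<close> a
    polynomial in \<open>?V\<close>.\<close>
  have V: "?V * fps_exp 2 = 1 - ?V"
    using inverse_mult_eq_1[of "fps_exp 2 + 1 :: real fps"] by (simp add: algebra_simps)
  have "fps_deriv ?V = - (fps_const 2 * (?V * fps_exp 2)) * ?V"
    by (subst fps_inverse_deriv) (simp_all add: power2_eq_square algebra_simps)
  also have "\<dots> = - (2 * (1 - ?V) * ?V)"
    unfolding V by (simp add: fps_numeral_fps_const)
  finally have "fps_deriv ?V = - (2 * (1 - ?V) * ?V)" .
  moreover have "fps_deriv fps_tanh = - 2 * fps_deriv ?V"
    by (simp add: fps_tanh_def)
  ultimately show ?thesis
    by (simp only: fps_tanh_def) (simp add: power2_eq_square algebra_simps)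
qed

text \<open>With \<open>E = exp (2 z)\<close>, the partial fractions
  \<open>2 / (E + 1) = 2 / (E - 1) - 4 / (E\<^sup>2 - 1)\<close> express \<open>z tanh z\<close>
  through \<open>b (2 z)\<close> and \<open>b (4 z)\<close>.\<close>

lemma fps_tanh_bernoulli:
  "fps_X * fps_tanh =
     fps_X + Abs_fps (\<lambda>n. (4 ^ n - 2 ^ n) * (bernoulli_number n / fact n))"
proof -
  define b where "b = Abs_fps (\<lambda>n. bernoulli_number n / fact n)"
  \<comment> \<open>\<open>bc c\<close> is \<open>b (c z) = c z / (exp (c z) - 1)\<close>.\<close>
  define bc where "bc = (\<lambda>c. b oo (fps_const c * fps_X))"
  have bc: "bc c * (fps_exp c - 1) = fps_const c * fps_X" for c
  proof -
    have "(b * (fps_exp 1 - 1)) oo (fps_const c * fps_X) = fps_X oo (fps_const c * fps_X)"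
      by (simp add: b_def bernoulli_number_gf_mult)
    thus ?thesis
      by (simp add: bc_def fps_compose_mult_distrib fps_compose_sub_distrib fps_exp_compose_linear)
  qed
  let ?E = "fps_exp 2 :: real fps"
  have E4: "fps_exp 4 = ?E * ?E"
    by (simp add: fps_exp_add_mult[symmetric])
  \<comment> \<open>The common denominator \<open>exp (4 z) - 1 = (E - 1) * (E + 1)\<close> is
    cleared, and cancelled at the end.\<close>
  have "(fps_X * fps_tanh) * (fps_exp 4 - 1) = fps_X * (?E - 1) * (fps_tanh * (?E + 1))"
    by (simp add: E4 algebra_simps)
  also have "\<dots> = fps_X * (?E - 1) * (?E - 1)"
    by (simp add: fps_tanh_mult)
  also have "\<dots> = fps_X * (fps_exp 4 - 1) + fps_const 4 * fps_X - (fps_const 2 * fps_X) * (?E + 1)"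
    by (simp add: E4 fps_numeral_fps_const[symmetric] algebra_simps)
  also have "\<dots> = (fps_X + bc 4 - bc 2) * (fps_exp 4 - 1)"
    unfolding bc[symmetric] by (simp add: E4 algebra_simps)
  finally have "(fps_X * fps_tanh) * (fps_exp 4 - 1) = (fps_X + bc 4 - bc 2) * (fps_exp 4 - 1)" .
  moreover have "fps_nth (fps_exp 4 - 1 :: real fps) 1 \<noteq> 0" by simp
  hence "fps_exp 4 - 1 \<noteq> (0 :: real fps)" by (metis fps_zero_nth)
  ultimately have "fps_X * fps_tanh = fps_X + bc 4 - bc 2" by simp
  also have "\<dots> = fps_X + Abs_fps (\<lambda>n. (4 ^ n - 2 ^ n) * (bernoulli_number n / fact n))"
    by (rule fps_ext) (simp add: bc_def b_def fps_compose_linear left_diff_distrib diff_divide_distrib)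
  finally show ?thesis .
qed

lemma fps_tan_mult_cos: "fps_tan 1 * fps_cos 1 = (fps_sin 1 :: real fps)"
  by (simp add: fps_tan_def fps_divide_unit mult.assoc inverse_mult_eq_1)

text \<open>Differentiating \<open>tan * cos = sin\<close> avoids a quotient rule; the cosine is
  then cancelled.\<close>

lemma fps_tan_1_deriv: "fps_deriv (fps_tan 1) = 1 + (fps_tan 1 :: real fps)\<^sup>2"
proof -
  let ?c = "fps_cos 1 :: real fps"
  have "fps_nth ?c 0 \<noteq> 0" by simp
  hence "?c \<noteq> 0" by (metis fps_zero_nth)
  have "fps_deriv (fps_tan 1 * ?c) = ?c"
    by (simp add: fps_tan_mult_cos fps_sin_deriv)
  hence "fps_deriv (fps_tan 1) * ?c = ?c + fps_tan 1 * fps_sin 1"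
    by (simp add: fps_cos_1_deriv algebra_simps)
  also have "\<dots> = (1 + (fps_tan 1)\<^sup>2) * ?c"
    by (simp add: fps_tan_mult_cos[symmetric] power2_eq_square algebra_simps)
  finally show ?thesis using \<open>?c \<noteq> 0\<close> by simp
qed

lemma fps_tan_1_nth_0: "fps_nth (fps_tan 1 :: real fps) 0 = 0"
  by (simp add: fps_tan_def fps_divide_unit)

text \<open>The index 0 must be excluded: since the Bernoulli number of index 1 is
  \<open>- 1 / 2\<close>, the right-hand side would be 1 there, whereas the tangent has constant
  term 0.\<close>

lemma fps_tan_1_nth:
  assumes "j \<ge> 1"
  shows "fps_nth (fps_tan 1) j =
    2 ^ (j + 1) * (2 ^ (j + 1) - 1) * \<bar>bernoulli_number (j + 1)\<bar> / fact (j + 1)"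
proof -
  have tanh0: "fps_nth fps_tanh 0 = 0" by (simp add: fps_tanh_def)
  have R: "fps_nth (fps_tan 1 :: real fps) j \<ge> 0 \<and>
      fps_nth fps_tanh j = (- 1) ^ (j div 2) * fps_nth (fps_tan 1) j"
    using fps_riccati_nth[OF fps_tanh_deriv tanh0 fps_tan_1_deriv fps_tan_1_nth_0, of j] by simp
  hence "fps_nth (fps_tan 1) j = \<bar>fps_nth fps_tanh j\<bar>"
    by (simp add: abs_mult)
  \<comment> \<open>The index shifts by one because of the factor \<open>fps_X\<close>; for
    \<open>j \<ge> 1\<close> the summand \<open>fps_X\<close> does not reach the coefficient
    \<open>j + 1\<close>.\<close>
  moreover have "fps_nth fps_tanh j =
      (4 ^ (j + 1) - 2 ^ (j + 1)) * (bernoulli_number (j + 1) / fact (j + 1))"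
    using arg_cong[OF fps_tanh_bernoulli, of "\<lambda>f. fps_nth f (j + 1)"] assms by simp
  moreover have "(4 :: real) ^ (j + 1) - 2 ^ (j + 1) = 2 ^ (j + 1) * (2 ^ (j + 1) - 1)"
    by (simp add: right_diff_distrib power_mult_distrib[symmetric])
  moreover have "(2 :: real) ^ (j + 1) - 1 \<ge> 0"
    using one_le_power[of "2 :: real" "j + 1"] by simp
  ultimately show ?thesis by (simp only: abs_mult abs_divide) simp
qed

text \<open>Comparing coefficients in \<open>F' = (x - tan z) F\<close> and multiplying by
  \<open>fact n\<close> produces the binomial coefficients.\<close>

lemma alpha_bernoulli_recurrence:
  "poly (alpha (n + 1)) x = x * poly (alpha n) x -
     (\<Sum>j=1..n. 2 ^ (j + 1) * (2 ^ (j + 1) - 1) / real (j + 1) * real (n choose j) *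
        \<bar>bernoulli_number (j + 1)\<bar> * poly (alpha (n - j)) x)"
proof -
  define F where "F = Abs_fps (\<lambda>n. poly (alpha n) x / fact n)"
  have "fps_deriv F = fps_const x * F - fps_tan 1 * F"
    unfolding F_def alpha_egf
    by (simp add: fps_cos_1_deriv mult.assoc[symmetric] fps_tan_mult_cos)
  from arg_cong[OF this, of "\<lambda>f. fps_nth f n"]
  have "real (n + 1) * (poly (alpha (n + 1)) x / fact (n + 1)) =
      x * (poly (alpha n) x / fact n) -
      (\<Sum>j=0..n. fps_nth (fps_tan 1) j * (poly (alpha (n - j)) x / fact (n - j)))"
    by (simp add: F_def fps_mult_nth[of "fps_tan 1"] del: fact_Suc)
  moreover have "real (n + 1) * (poly (alpha (n + 1)) x / fact (n + 1)) = poly (alpha (n + 1)) x / fact n"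
    by (simp only: Suc_eq_plus1[symmetric] fact_Suc) (simp del: of_nat_Suc)
  ultimately have "poly (alpha (n + 1)) x / fact n = x * (poly (alpha n) x / fact n) -
      (\<Sum>j=0..n. fps_nth (fps_tan 1) j * (poly (alpha (n - j)) x / fact (n - j)))" by simp
  hence "poly (alpha (n + 1)) x = x * poly (alpha n) x -
      (\<Sum>j=0..n. fact n * (fps_nth (fps_tan 1) j * (poly (alpha (n - j)) x / fact (n - j))))"
    by (simp add: field_simps sum_distrib_left)
  \<comment> \<open>The tangent has zero constant term, so the sum starts at 1, where its
    coefficient formula applies.\<close>
  also have "(\<Sum>j=0..n. fact n * (fps_nth (fps_tan 1) j * (poly (alpha (n - j)) x / fact (n - j)))) =
      (\<Sum>j=1..n. fact n * (fps_nth (fps_tan 1) j * (poly (alpha (n - j)) x / fact (n - j))))"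
    by (simp add: sum.atLeast_Suc_atMost fps_tan_1_nth_0)
  also have "\<dots> = (\<Sum>j=1..n. 2 ^ (j + 1) * (2 ^ (j + 1) - 1) / real (j + 1) * real (n choose j) *
        \<bar>bernoulli_number (j + 1)\<bar> * poly (alpha (n - j)) x)"
  proof (rule sum.cong)
    fix j assume j: "j \<in> {1..n}"
    have "real (n choose j) = fact n / (fact j * fact (n - j))"
      using j by (simp add: binomial_fact)
    \<comment> \<open>This splits off the denominator \<open>j + 1\<close> and leaves the
      \<open>fact j\<close> of the binomial coefficient.\<close>
    moreover have "(fact (j + 1) :: real) = real (j + 1) * fact j" by simp
    ultimately show "fact n * (fps_nth (fps_tan 1) j * (poly (alpha (n - j)) x / fact (n - j))) =
        2 ^ (j + 1) * (2 ^ (j + 1) - 1) / real (j + 1) * real (n choose j) *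
        \<bar>bernoulli_number (j + 1)\<bar> * poly (alpha (n - j)) x"
      using j by (simp only: fps_tan_1_nth atLeastAtMost_iff) (simp add: mult_ac)
  qed simp
  finally show ?thesis .
qed

theorem theorem12:
  shows
    "(\<forall>x. Abs_fps (\<lambda>n. poly (alpha n) x) =
        (1 - fps_const x * fps_X) /
        (1 - fps_const (2 * x) * fps_X + fps_const (1 + x\<^sup>2) * fps_X\<^sup>2))
   \<and> (\<forall>x. Abs_fps (\<lambda>n. poly (alpha n) x / fact n) = fps_cos 1 * fps_exp x)
   \<and> ((\<forall>n\<ge>1. \<forall>x. poly (alpha (n + 1)) x =
          2 * x * poly (alpha n) x - (1 + x\<^sup>2) * poly (alpha (n - 1)) x) \<and>
      (\<forall>x. poly (alpha 0) x = 1) \<and> (\<forall>x. poly (alpha 1) x = x))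
   \<and> ((\<forall>n x. poly (alpha n) x =
          vec_of_list [1, x] \<bullet>
            ((mat_of_rows_list 2 [[0, - (1 + x\<^sup>2)], [1, 2 * x]] ^\<^sub>m n) *\<^sub>v vec_of_list [1, 0])) \<and>
      (\<forall>n\<ge>1. \<forall>x. poly (alpha n) x = det (alpha_tridiagonal n x)) \<and>
      (\<forall>n x. poly (alpha n) x =
          sqrt (1 + x\<^sup>2) ^ n * poly (chebyshev_T n) (x / sqrt (1 + x\<^sup>2))))
   \<and> (\<forall>n x. poly (alpha n) (- x) = (- 1) ^ n * poly (alpha n) x)
   \<and> (\<forall>n\<ge>1. \<forall>x. poly (pderiv (alpha n)) x = real n * poly (alpha (n - 1)) x)
   \<and> (\<forall>n x. (1 + x\<^sup>2) * poly (pderiv (pderiv (alpha n))) x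
          - 2 * (real n - 1) * x * poly (pderiv (alpha n)) x
          + real n * (real n - 1) * poly (alpha n) x = 0)
   \<and> (\<forall>n\<ge>1. degree (alpha n) = n \<and>
        (let X = (\<lambda>k. cot ((2 * real k - 1) * pi / (2 * real n))) in
           inj_on X {1..n} \<and>
           {x. poly (alpha n) x = 0} = X ` {1..n} \<and>
           (\<forall>k\<in>{1..n}. order (X k) (alpha n) = 1)))
   \<and> ((\<forall>x. poly (alpha 0) x = 1) \<and>
      (\<forall>n x. poly (alpha (n + 1)) x = x * poly (alpha n) x -
          (\<Sum>j=1..n. 2 ^ (j + 1) * (2 ^ (j + 1) - 1) / real (j + 1) * real (n choose j) *
             \<bar>bernoulli_number (j + 1)\<bar> * poly (alpha (n - j)) x)))"
proof (intro conjI allI impI)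
  fix n :: nat and x :: real assume "n \<ge> 1"
  thus "poly (alpha (n + 1)) x =
      2 * x * poly (alpha n) x - (1 + x\<^sup>2) * poly (alpha (n - 1)) x"
    by (cases n) (simp_all add: poly_alpha_recurrence)
next
  fix x show "poly (alpha 1) x = x"
    by (simp add: poly_alpha)
next
  fix n x
  show "poly (alpha n) x = vec_of_list [1, x] \<bullet>
      ((mat_of_rows_list 2 [[0, - (1 + x\<^sup>2)], [1, 2 * x]] ^\<^sub>m n) *\<^sub>v vec_of_list [1, 0])"
    by (rule alpha_matrix_power[symmetric])
  show "(1 + x\<^sup>2) * poly (pderiv (pderiv (alpha n))) x
      - 2 * (real n - 1) * x * poly (pderiv (alpha n)) x
      + real n * (real n - 1) * poly (alpha n) x = 0"
    by (rule alpha_ode)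
next
  fix n :: nat assume n: "n \<ge> 1"
  show "degree (alpha n) = n" by (rule degree_alpha)
  show "let X = \<lambda>k. cot ((2 * real k - 1) * pi / (2 * real n))
      in inj_on X {1..n} \<and> {x. poly (alpha n) x = 0} = X ` {1..n} \<and>
         (\<forall>k\<in>{1..n}. order (X k) (alpha n) = 1)"
    unfolding Let_def using alpha_roots[OF n] alpha_simple_root by blast
qed (simp_all add: alpha_ogf alpha_egf poly_alpha_0 det_alpha_tridiagonal
  poly_alpha_minus pderiv_alpha
  alpha_bernoulli_recurrence[simplified] flip: alpha_chebyshev)

end
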